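(* Let $M$ be a binomial random variable with $n\in\mathbb{N}$ trials and success probability $p\in(0,1]$. Then $$\mathbb{E}[J(n)-J(M)]=\sum_{m=1}^n\frac{(1-p)^m}{m}=-\log p-\sum_{m=n+1}^\infty\frac{(1-p)^m}{m}.$$
   Context: $\mathbb{N}=\{1,2,3,\dots\}$, $\log$ is the natural logarithm, and $J(m)=\sum_{k=1}^m 1/k$ is the $m$-th harmonic number with $J(0)=0$. *)

theory Defs
  imports "HOL-Probability.Probability"
begin

end

theory Submission
  imports Defs
begin

text \<open>Conditioning on the last trial, the expected harmonic number of a binomial variable grows by
  \<open>p E[1 / (M + 1)] = (1 - (1 - p) ^ (n + 1)) / (n + 1)\<close> from \<open>n\<close> to \<open>n + 1\<close> trials, since
  \<open>(n choose k) / (k + 1) = (n + 1 choose k + 1) / (n + 1)\<close>. Hence the expectation of the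
  difference grows by \<open>(1 - p) ^ (n + 1) / (n + 1)\<close>. The second identity is the
  Mercator series at \<open>1 - p\<close>.\<close>

text \<open>Pascal's rule, read as conditioning on the last trial: a failure (weight
  \<open>q\<close>) leaves the count at \<open>k\<close>, a success (weight \<open>p\<close>) moves
  it to \<open>Suc k\<close>.\<close>

lemma sum_binomial_Suc:
  fixes p q :: "'a::comm_semiring_1"
  shows "(\<Sum>k\<le>Suc n. of_nat (Suc n choose k) * p ^ k * q ^ (Suc n - k) * f k)
    = q * (\<Sum>k\<le>n. of_nat (n choose k) * p ^ k * q ^ (n - k) * f k)
      + p * (\<Sum>k\<le>n. of_nat (n choose k) * p ^ k * q ^ (n - k) * f (Suc k))"
proof -
  have "(\<Sum>k\<le>Suc n. of_nat (Suc n choose k) * p ^ k * q ^ (Suc n - k) * f k)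
    = q ^ Suc n * f 0
      + (\<Sum>k\<le>n. of_nat (n choose Suc k) * p ^ Suc k * q ^ (n - k) * f (Suc k))
      + (\<Sum>k\<le>n. of_nat (n choose k) * p ^ Suc k * q ^ (n - k) * f (Suc k))"
    by (subst sum.atMost_Suc_shift) (simp add: sum.distrib algebra_simps)
  \<comment> \<open>The isolated term is the one at \<open>k = 0\<close> of a sum up to
    \<open>Suc n\<close>. The top term of that sum vanishes since \<open>n choose Suc n = 0\<close>,
    after which a factor \<open>q\<close> comes out of every remaining term.\<close>
  moreover have "q ^ Suc n * f 0
      + (\<Sum>k\<le>n. of_nat (n choose Suc k) * p ^ Suc k * q ^ (n - k) * f (Suc k))
    = (\<Sum>k\<le>Suc n. of_nat (n choose k) * p ^ k * q ^ (Suc n - k) * f k)"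
    by (subst sum.atMost_Suc_shift) simp
  moreover have "\<dots> = q * (\<Sum>k\<le>n. of_nat (n choose k) * p ^ k * q ^ (n - k) * f k)"
    by (simp add: sum_distrib_left Suc_diff_le binomial_eq_0 algebra_simps)
  moreover have "(\<Sum>k\<le>n. of_nat (n choose k) * p ^ Suc k * q ^ (n - k) * f (Suc k))
    = p * (\<Sum>k\<le>n. of_nat (n choose k) * p ^ k * q ^ (n - k) * f (Suc k))"
    by (simp add: sum_distrib_left algebra_simps)
  ultimately show ?thesis
    by (simp only:)
qed

text \<open>Once \<open>1 / (k + 1)\<close> is absorbed into the coefficient, the outer factor
  \<open>p\<close> completes \<open>p ^ Suc k\<close>, so the sum is the expansion of
  \<open>(p + q) ^ Suc n\<close> without its term \<open>q ^ Suc n\<close> at index 0. Keeping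
  \<open>p\<close> on the left avoids dividing by it.\<close>

lemma sum_binomial_inverse_Suc:
  fixes p q :: "'a::field_char_0"
  shows "p * (\<Sum>k\<le>n. of_nat (n choose k) * p ^ k * q ^ (n - k) * inverse (of_nat (Suc k)))
    = ((p + q) ^ Suc n - q ^ Suc n) / of_nat (Suc n)"
proof -
  have coeff: "of_nat (n choose k) * inverse (of_nat (Suc k))
      = (of_nat (Suc n choose Suc k) / of_nat (Suc n) :: 'a)" for k
  proof -
    have "of_nat (Suc n) * of_nat (n choose k) = (of_nat (Suc n choose Suc k) * of_nat (Suc k) :: 'a)"
      using Suc_times_binomial_eq[of n k] by (metis of_nat_mult)
    moreover have "(of_nat (Suc k) :: 'a) \<noteq> 0" "(of_nat (Suc n) :: 'a) \<noteq> 0"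
      by (simp_all only: of_nat_eq_0_iff nat.distinct not_False_eq_True)
    ultimately show ?thesis
      by (simp add: divide_simps mult_ac del: of_nat_Suc binomial_Suc_Suc)
  qed
  have "p * (\<Sum>k\<le>n. of_nat (n choose k) * p ^ k * q ^ (n - k) * inverse (of_nat (Suc k)))
    = (\<Sum>k\<le>n. (of_nat (n choose k) * inverse (of_nat (Suc k))) * p ^ Suc k * q ^ (n - k))"
    by (simp add: sum_distrib_left mult_ac)
  also have "\<dots> = (\<Sum>k\<le>n. of_nat (Suc n choose Suc k) * p ^ Suc k * q ^ (n - k)) / of_nat (Suc n)"
    unfolding coeff sum_divide_distrib by simp
  also have "(\<Sum>k\<le>n. of_nat (Suc n choose Suc k) * p ^ Suc k * q ^ (n - k))
    = (p + q) ^ Suc n - q ^ Suc n"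
    unfolding binomial_ring[of p q "Suc n"]
    unfolding sum.atMost_Suc_shift by (simp del: binomial_Suc_Suc)
  finally show ?thesis .
qed

lemma sum_binomial_harm:
  fixes p q :: real
  assumes "p + q = 1"
  shows "harm n - (\<Sum>k\<le>n. real (n choose k) * p ^ k * q ^ (n - k) * harm k)
    = (\<Sum>m=1..n. q ^ m / real m)"
proof (induction n)
  case 0
  then show ?case by (simp add: harm_def)
next
  case (Suc n)
  define g where "g = (\<lambda>n. \<Sum>k\<le>n. real (n choose k) * p ^ k * q ^ (n - k) * harm k)"
  have "g (Suc n) = q * g n
      + p * (\<Sum>k\<le>n. real (n choose k) * p ^ k * q ^ (n - k) * harm (Suc k))"
    unfolding g_def by (rule sum_binomial_Suc)
  \<comment> \<open>In the success part, \<open>harm (Suc k) = harm k + 1 / (k + 1)\<close>; the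
    \<open>harm k\<close> share is \<open>p * g n\<close> and joins \<open>q * g n\<close>.\<close>
  also have "\<dots> = (p + q) * g n
      + p * (\<Sum>k\<le>n. real (n choose k) * p ^ k * q ^ (n - k) * inverse (real (Suc k)))"
    by (simp add: g_def harm_Suc ring_distribs sum.distrib del: of_nat_Suc)
  also have "\<dots> = g n + (1 - q ^ Suc n) / real (Suc n)"
    unfolding sum_binomial_inverse_Suc assms by simp
  finally have "harm (Suc n) - g (Suc n) = harm n - g n + q ^ Suc n / real (Suc n)"
    by (simp add: harm_Suc diff_divide_distrib inverse_eq_divide del: of_nat_Suc)
  with Suc show ?case
    by (simp add: g_def del: of_nat_Suc)
qed

text \<open>The Mercator series at \<open>- x\<close>, negated. The index starts at 0, where the
  term is \<open>1 / 0 = 0\<close> by convention.\<close>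

lemma ln_one_minus_sums:
  fixes x :: real
  assumes "\<bar>x\<bar> < 1"
  shows "(\<lambda>n. x ^ n / real n) sums (- ln (1 - x))"
  using sums_minus[OF ln_series'[of "- x"]] assms
  by (simp add: power_minus' flip: power_mult_distrib)

theorem mainTheorem4:
  fixes P :: "'a measure" and M :: "'a \<Rightarrow> nat" and n :: nat and p :: real
  assumes "prob_space P"
    and "M \<in> measurable P (count_space UNIV)"
    and "distr P (count_space UNIV) M = measure_pmf (binomial_pmf n p)"
    and "n \<ge> 1" and "0 < p" and "p \<le> 1"
  shows "integrable P (\<lambda>\<omega>. (harm n :: real) - harm (M \<omega>))
    \<and> prob_space.expectation P (\<lambda>\<omega>. (harm n :: real) - harm (M \<omega>))
        = (\<Sum>m=1..n. (1 - p) ^ m / real m)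
    \<and> summable (\<lambda>k. (1 - p) ^ (n + 1 + k) / real (n + 1 + k))
    \<and> (\<Sum>m=1..n. (1 - p) ^ m / real m)
        = - ln p - (\<Sum>k. (1 - p) ^ (n + 1 + k) / real (n + 1 + k))"
proof -
  let ?B = "binomial_pmf n p"
  have p: "p \<in> {0..1}" using assms by simp
  \<comment> \<open>The binomial law has finite support, so every real function is integrable
    against it; this transfers to \<open>P\<close> along \<open>M\<close>.\<close>
  have int: "integrable P (\<lambda>\<omega>. f (M \<omega>))" for f :: "nat \<Rightarrow> real"
    using integrable_binomial_pmf[OF p, of n f] assms(2) integrable_distr[of M P "count_space UNIV" f]
    by (simp add: assms(3))
  have "measure_pmf.expectation ?B (\<lambda>k. (harm n :: real) - harm k)
      = harm n - measure_pmf.expectation ?B harm"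
    using p by simp
  also have "measure_pmf.expectation ?B (harm :: nat \<Rightarrow> real)
      = (\<Sum>k\<le>n. real (n choose k) * p ^ k * (1 - p) ^ (n - k) * harm k)"
    using expectation_binomial_pmf'[OF p, of n "harm :: nat \<Rightarrow> real"] by simp
  also have "harm n - \<dots> = (\<Sum>m=1..n. (1 - p) ^ m / real m)"
    by (rule sum_binomial_harm) simp
  finally have exp_B: "measure_pmf.expectation ?B (\<lambda>k. (harm n :: real) - harm k)
      = (\<Sum>m=1..n. (1 - p) ^ m / real m)" .
  have exp_P: "prob_space.expectation P (\<lambda>\<omega>. (harm n :: real) - harm (M \<omega>))
      = measure_pmf.expectation ?B (\<lambda>k. harm n - harm k)"
    using integral_distr[OF assms(2), of "\<lambda>k. (harm n :: real) - harm k"]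
    by (simp add: assms(3))
  \<comment> \<open>Here \<open>0 < p \<le> 1\<close> gives
    \<open>\<bar>1 - p\<bar> < 1\<close>.\<close>
  have sums: "(\<lambda>m. (1 - p) ^ m / real m) sums (- ln p)"
    using ln_one_minus_sums[of "1 - p"] assms by simp
  \<comment> \<open>The extra index 0 contributes \<open>1 / 0 = 0\<close>.\<close>
  have initial: "(\<Sum>m<n + 1. (1 - p) ^ m / real m) = (\<Sum>m=1..n. (1 - p) ^ m / real m)"
    by (rule sum.mono_neutral_right) auto
  have "(\<lambda>k. (1 - p) ^ (k + (n + 1)) / real (k + (n + 1)))
      sums (- ln p - (\<Sum>m=1..n. (1 - p) ^ m / real m))"
    using sums_split_initial_segment[OF sums, of "n + 1"] unfolding initial .
  \<comment> \<open>This yields both the summability of the tail and its value, from which the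
    second identity follows by rearranging.\<close>
  then have tail: "(\<lambda>k. (1 - p) ^ (n + 1 + k) / real (n + 1 + k))
      sums (- ln p - (\<Sum>m=1..n. (1 - p) ^ m / real m))"
    by (simp only: add.commute[of _ "n + 1"])
  show ?thesis
    using int[of "\<lambda>k. harm n - harm k"] exp_B exp_P tail
    by (simp add: sums_iff)
qed

end
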